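(* Let $\mathcal{B}$ be a homothecy invariant collection of rectangular parallelepipeds in $\mathbb{R}^{n}$. Suppose that for some $0<\gamma<1$ and some finite constant $C$ the maximal operator $M_{\mathcal{B}}$ satisfies the Tauberian condition $$\left|\left\{x\in\mathbb{R}^n : M_{\mathcal{B}}\chi_{E}(x) > \gamma\right\}\right| \leq C|E|$$ for all measurable sets $E\subset\mathbb{R}^{n}$. Then, with the same constant $C$, $$\left|\left\{x\in\mathbb{R}^n : M_{\mathcal{B}}\chi_{E}(x) \geq \gamma\right\}\right| \leq C|E|$$ for all measurable sets $E\subset\mathbb{R}^{n}$.
   Context: $|\cdot|$ denotes Lebesgue measure on $\mathbb{R}^n$ and $\chi_E$ the characteristic function of $E$. Rectangular parallelepipeds have positive measure, and their sides are not required to be parallel to the coordinate axes. A collection $\mathcal{B}$ of sets is homothecy invariant if for every $R\in\mathcal{B}$, $r>0$ and $a\in\mathbb{R}^n$, the set $a+rR$ also belongs to $\mathcal{B}$. The geometric maximal operator associated to $\mathcal{B}$ is $M_{\mathcal{B}}f(x)=\sup_{x\in R\in\mathcal{B}}\frac{1}{|R|}\int_R|f|$. *)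

theory Defs
  imports "HOL-Analysis.Analysis"
begin

text \<open>Rotated products of bounded intervals. The intervals may be open, closed or half-open, so
  that every usual convention on the boundary of a parallelepiped is covered. Translations need not
  be mentioned, since an orthogonal transformation maps translates to translates.\<close>

definition rectangular_parallelepiped :: "(real ^ 'n) set \<Rightarrow> bool" where
  "rectangular_parallelepiped R \<longleftrightarrow>
     (\<exists>(T :: real ^ 'n \<Rightarrow> real ^ 'n) (I :: 'n \<Rightarrow> real set).
        orthogonal_transformation T \<and>
        (\<forall>i. is_interval (I i) \<and> bounded (I i)) \<and>
        R = T ` {x. \<forall>i. x $ i \<in> I i}) \<and>
     0 < emeasure lebesgue R"

definition homothecy_invariant :: "(real ^ 'n) set set \<Rightarrow> bool" where
  "homothecy_invariant B \<longleftrightarrow>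
     (\<forall>R\<in>B. \<forall>r>0. \<forall>a. (\<lambda>x. a + r *\<^sub>R x) ` R \<in> B)"

text \<open>The value lies in the extended nonnegative reals; it is 0 at a point that no member of the
  collection contains. If the collection is homothecy invariant and consists of rectangular
  parallelepipeds, then the sets where the maximal function exceeds a given value are open (a
  parallelepiped lies in the interior of its concentric dilates by factors greater than 1; the
  integral does not decrease under dilation, and the measure depends continuously on the factor),
  so the sets where it is at least a given value are
  Borel. Hence no level set is assigned the default measure 0 of nonmeasurable sets.\<close>

definition maximal_operator :: "(real ^ 'n) set set \<Rightarrow> (real ^ 'n \<Rightarrow> real) \<Rightarrow> real ^ 'n \<Rightarrow> ennreal" where
  "maximal_operator B f x =
     (SUP R\<in>{R\<in>B. x \<in> R}.
        (\<integral>\<^sup>+y\<in>R. ennreal \<bar>f y\<bar> \<partial>lebesgue) / emeasure lebesgue R)"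

end

theory Submission
  imports Defs
begin

text \<open>If finitely many members $R_1,\dots,R_k$ of the collection have density greater than
  $s = (\gamma-\epsilon)/(1-\epsilon) < \gamma$ with respect to $E$, there is a set $N$ of measure
  $\epsilon\,|\bigcup_j R_j \setminus E|$ which occupies the proportion $\epsilon$ of every
  $R_j\setminus E$. Each $R_j$ then has density greater than $(1-\epsilon)s+\epsilon=\gamma$ with
  respect to $E\cup N$, so that $|\bigcup_j R_j| \le C|E| + C\epsilon|\bigcup_j R_j|$ by the Tauberian
  condition. By the Lindelof property countably many such $R_j$ cover the set where
  $M_B\chi_E\ge\gamma$, hence that set has measure at most $C|E|/(1-C\epsilon)$, and $\epsilon$ can
  tend to $0$.\<close>

section \<open>Subsets that occupy a prescribed proportion\<close>

text \<open>The measure of \<open>X \<inter> ball 0 t\<close> varies continuously with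
  \<open>t\<close>, vanishes at \<open>t = 0\<close> and tends to the measure of \<open>X\<close>,
  so the intermediate value theorem supplies a suitable radius.\<close>

lemma lmeasurable_subset_of_proportion:
  fixes X :: "'a::euclidean_space set"
  assumes X: "X \<in> lmeasurable" and e: "0 \<le> e" "e < 1"
  obtains Y where "Y \<in> lmeasurable" "Y \<subseteq> X" "measure lebesgue Y = e * measure lebesgue X"
proof (cases "measure lebesgue X = 0")
  case True
  then show ?thesis
    using that[of "{}"] by simp
next
  case False
  then have pos: "measure lebesgue X > 0"
    by (simp add: zero_less_measure_iff)
  define f where "f t = measure lebesgue (X \<inter> ball 0 t)" for t
  have meas: "X \<inter> ball 0 t \<in> lmeasurable" for t
    using X by (simp add: fmeasurable_Int_fmeasurable)
  \<comment> \<open>Increments of \<open>f\<close> are dominated by those of the volume of the ball,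
    a polynomial in the radius; continuity of \<open>f\<close> is inherited from it.\<close>
  have incr: "f t - f s \<le> measure lebesgue (ball (0::'a) t) - measure lebesgue (ball (0::'a) s)"
    "f s \<le> f t" if "s \<le> t" for s t
  proof -
    have sub: "ball (0::'a) s \<subseteq> ball 0 t"
      using that by auto
    have "f t - f s = measure lebesgue (X \<inter> ball 0 t - X \<inter> ball 0 s)"
      unfolding f_def using sub by (intro measurable_measure_Diff[symmetric] meas fmeasurableD) auto
    also have "\<dots> \<le> measure lebesgue (ball (0::'a) t - ball 0 s)"
      by (intro measure_mono_fmeasurable fmeasurable_Diff) (auto intro: sets.Diff fmeasurableD meas)
    also have "\<dots> = measure lebesgue (ball (0::'a) t) - measure lebesgue (ball (0::'a) s)"
      using sub by (intro measurable_measure_Diff) auto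
    finally show "f t - f s \<le> measure lebesgue (ball (0::'a) t) - measure lebesgue (ball (0::'a) s)" .
    show "f s \<le> f t"
      unfolding f_def using sub by (intro measure_mono_fmeasurable) (auto intro: fmeasurableD meas)
  qed
  have "(\<lambda>n. f (real n)) \<longlonglongrightarrow> measure lebesgue (\<Union>n. X \<inter> ball 0 (real n))"
    unfolding f_def
  proof (rule Lim_measure_incseq)
    show "range (\<lambda>n. X \<inter> ball 0 (real n)) \<subseteq> sets lebesgue"
      using meas by (auto dest: fmeasurableD)
    show "incseq (\<lambda>n. X \<inter> ball 0 (real n))"
      by (force simp: incseq_def)
    have "(\<Union>n. X \<inter> ball 0 (real n)) = X"
      using reals_Archimedean2 by auto
    then show "emeasure lebesgue (\<Union>n. X \<inter> ball 0 (real n)) \<noteq> \<infinity>"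
      using fmeasurableD2[OF X] by simp
  qed
  moreover have "(\<Union>n. X \<inter> ball 0 (real n)) = X"
    using reals_Archimedean2 by auto
  ultimately have "(\<lambda>n. f (real n)) \<longlonglongrightarrow> measure lebesgue X"
    by (simp only:)
  \<comment> \<open>Strictness guarantees that the target value is passed at a finite radius; it
    fails for null \<open>X\<close>, hence the case distinction.\<close>
  moreover have "e * measure lebesgue X < measure lebesgue X"
    using e pos by simp
  ultimately have "\<forall>\<^sub>F n in sequentially. e * measure lebesgue X < f (real n)"
    by (rule order_tendstoD)
  then obtain n where n: "e * measure lebesgue X < f (real n)"
    by (auto simp: eventually_sequentially)
  have "continuous_on {0..real n} f"
    unfolding continuous_on_def
  proof
    fix x assume x: "x \<in> {0..real n}"
    define g where "g t = measure lebesgue (ball (0::'a) t)" for t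
    have cont: "continuous_on {0..real n} (\<lambda>t. unit_ball_vol (real DIM('a)) * t ^ DIM('a))"
      by (intro continuous_intros)
    have "continuous_on {0..real n} g"
      by (rule continuous_on_cong[THEN iffD1, OF refl _ cont]) (simp add: g_def content_ball)
    then have "(g \<longlongrightarrow> g x) (at x within {0..real n})"
      using x by (simp add: continuous_on_def)
    then have "((\<lambda>t. \<bar>g t - g x\<bar>) \<longlongrightarrow> 0) (at x within {0..real n})"
      by (intro tendsto_rabs_zero LIM_zero)
    moreover have "norm (f t - f x) \<le> \<bar>g t - g x\<bar>" for t
      using incr[of t x] incr[of x t] unfolding g_def by (cases "t \<le> x") auto
    then have "\<forall>\<^sub>F t in at x within {0..real n}. norm (f t - f x) \<le> \<bar>g t - g x\<bar>"
      by (rule always_eventually[OF allI])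
    ultimately have "((\<lambda>t. f t - f x) \<longlongrightarrow> 0) (at x within {0..real n})"
      by (rule Lim_null_comparison[rotated])
    then show "(f \<longlongrightarrow> f x) (at x within {0..real n})"
      by (simp add: LIM_zero_iff)
  qed
  moreover have "f 0 \<le> e * measure lebesgue X"
    using e by (simp add: f_def)
  ultimately obtain t where "f t = e * measure lebesgue X"
    using IVT'[of f 0 "e * measure lebesgue X" "real n"] n by auto
  with that[of "X \<inter> ball 0 t"] meas show ?thesis
    by (auto simp: f_def)
qed

text \<open>Induction on \<open>F\<close>: the new set \<open>T\<close> cuts \<open>X\<close> into
  \<open>X \<inter> T\<close> and \<open>X - T\<close>, and the union of the subsets chosen in the
  two pieces has the right proportion in every set, since both sides are additive. The induction
  hypothesis is applied to two different sets, so \<open>X\<close> has to be arbitrary.\<close>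

lemma lmeasurable_subset_of_proportion_simultaneous:
  fixes X :: "'a::euclidean_space set"
  assumes "finite F" "\<And>S. S \<in> F \<Longrightarrow> S \<in> sets lebesgue" "X \<in> lmeasurable" "0 \<le> e" "e < 1"
  shows "\<exists>Y. Y \<in> lmeasurable \<and> Y \<subseteq> X \<and> measure lebesgue Y = e * measure lebesgue X \<and>
    (\<forall>S\<in>F. measure lebesgue (Y \<inter> S) = e * measure lebesgue (X \<inter> S))"
  using assms
proof (induction F arbitrary: X rule: finite_induct)
  case empty
  then show ?case
    using lmeasurable_subset_of_proportion[of X e] by auto
next
  case (insert T F)
  have T: "T \<in> sets lebesgue"
    using insert.prems by auto
  have X1: "X \<inter> T \<in> lmeasurable" and X2: "X - T \<in> lmeasurable"
    using T insert.prems by (auto intro: fmeasurable_Int_fmeasurable fmeasurable_Diff)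
  have split: "measure lebesgue (A \<union> A') = measure lebesgue A + measure lebesgue A'"
    if "A \<in> lmeasurable" "A' \<in> lmeasurable" "A \<subseteq> T" "A' \<inter> T = {}" for A A'
  proof -
    have "A \<inter> A' = {}"
      using that by blast
    then show ?thesis
      using measure_Un3[OF that(1,2)] by simp
  qed
  obtain Y1 where Y1: "Y1 \<in> lmeasurable" "Y1 \<subseteq> X \<inter> T"
      "measure lebesgue Y1 = e * measure lebesgue (X \<inter> T)"
      "\<forall>S\<in>F. measure lebesgue (Y1 \<inter> S) = e * measure lebesgue (X \<inter> T \<inter> S)"
    using insert.IH[OF _ X1] insert.prems by auto
  obtain Y2 where Y2: "Y2 \<in> lmeasurable" "Y2 \<subseteq> X - T"
      "measure lebesgue Y2 = e * measure lebesgue (X - T)"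
      "\<forall>S\<in>F. measure lebesgue (Y2 \<inter> S) = e * measure lebesgue ((X - T) \<inter> S)"
    using insert.IH[OF _ X2] insert.prems by auto
  have X: "measure lebesgue X = measure lebesgue (X \<inter> T) + measure lebesgue (X - T)"
  proof -
    have "X \<inter> T \<union> (X - T) = X" "(X - T) \<inter> T = {}"
      by blast+
    then show ?thesis
      using split[OF X1 X2] by simp
  qed
  have Y: "measure lebesgue (Y1 \<union> Y2) = measure lebesgue Y1 + measure lebesgue Y2"
    using Y1 Y2 by (intro split) auto
  have S: "measure lebesgue ((Y1 \<union> Y2) \<inter> S) = e * measure lebesgue (X \<inter> S)" if "S \<in> F" for S
  proof -
    have S: "S \<in> sets lebesgue"
      using that insert.prems by auto
    have "measure lebesgue (Y1 \<inter> S \<union> Y2 \<inter> S) = measure lebesgue (Y1 \<inter> S) + measure lebesgue (Y2 \<inter> S)"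
      using Y1(2) Y2(2) by (intro split fmeasurable_Int_fmeasurable[OF Y1(1) S] fmeasurable_Int_fmeasurable[OF Y2(1) S]) auto
    moreover have "measure lebesgue (X \<inter> T \<inter> S \<union> (X - T) \<inter> S)
        = measure lebesgue (X \<inter> T \<inter> S) + measure lebesgue ((X - T) \<inter> S)"
      by (intro split fmeasurable_Int_fmeasurable[OF X1 S] fmeasurable_Int_fmeasurable[OF X2 S]) auto
    moreover have "X \<inter> T \<inter> S \<union> (X - T) \<inter> S = X \<inter> S"
      by blast
    ultimately show ?thesis
      using Y1(4) Y2(4) that by (simp add: Int_Un_distrib2 distrib_left)
  qed
  \<comment> \<open>The claim for \<open>T\<close> itself thus reduces to the total measure of
    \<open>Y1\<close>, which is why the induction also carries the measure of
    \<open>Y\<close>.\<close>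
  have "(Y1 \<union> Y2) \<inter> T = Y1"
    using Y1 Y2 by blast
  then show ?case
    using X Y S Y1 Y2 by (intro exI[of _ "Y1 \<union> Y2"]) (auto simp: distrib_left)
qed

section \<open>Parallelepipeds and superlevel sets of the maximal function\<close>

lemma rectangular_parallelepipedD:
  fixes R :: "(real ^ 'n) set"
  assumes "rectangular_parallelepiped R"
  shows "convex R" "R \<in> lmeasurable" "0 < measure lebesgue R"
proof -
  have pos: "0 < emeasure lebesgue R" and
    "\<exists>(T :: real ^ 'n \<Rightarrow> real ^ 'n) (I :: 'n \<Rightarrow> real set). orthogonal_transformation T \<and>
      (\<forall>i. is_interval (I i) \<and> bounded (I i)) \<and> R = T ` {x. \<forall>i. x $ i \<in> I i}"
    using assms by (simp_all only: rectangular_parallelepiped_def)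
  then obtain T :: "real ^ 'n \<Rightarrow> real ^ 'n" and I :: "'n \<Rightarrow> real set" where
    T: "orthogonal_transformation T" and "\<forall>i. is_interval (I i) \<and> bounded (I i)"
    and R: "R = T ` {x. \<forall>i. x $ i \<in> I i}"
    by (elim exE conjE)
  then have I: "\<And>i. is_interval (I i)" "\<And>i. bounded (I i)"
    by simp_all
  have lin: "linear T"
    using T by (rule orthogonal_transformation_linear)
  have "convex {x. \<forall>i. x $ i \<in> I i}"
    using I(1) unfolding is_interval_convex_1 by (auto simp: convex_alt)
  then show "convex R"
    unfolding R using lin by (rule convex_linear_image[rotated])
  obtain b where b: "\<And>i t. t \<in> I i \<Longrightarrow> \<bar>t\<bar> \<le> b i"
    using I(2) unfolding bounded_iff real_norm_def by metis
  have "- b i \<le> t \<and> t \<le> b i" if "t \<in> I i" for i t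
    using b[OF that] by linarith
  then have "{x. \<forall>i. x $ i \<in> I i} \<subseteq> cbox (\<chi> i. - b i) (\<chi> i. b i)"
    by (auto simp: mem_box_cart)
  then have "bounded {x. \<forall>i. x $ i \<in> I i}"
    using bounded_cbox bounded_subset by blast
  then have "bounded R"
    unfolding R using lin linear_linear by (intro bounded_linear_image) auto
  \<comment> \<open>A bounded convex set is measurable whichever part of its boundary it contains,
    so open, closed and half-open sides are treated alike.\<close>
  with \<open>convex R\<close> show R': "R \<in> lmeasurable"
    by (rule measurable_convex)
  show "0 < measure lebesgue R"
    using pos R' by (simp add: emeasure_eq_measure2)
qed

text \<open>A supremum exceeds \<open>s\<close> strictly exactly when one of its terms does, and
  since members have finite positive measure the extended quotient becomes an inequality between
  reals. The condition \<open>0 \<le> s\<close> matters because \<open>ennreal\<close> sends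
  negative reals to 0.\<close>

lemma less_maximal_operator_indicator_iff:
  fixes B :: "(real ^ 'n) set set"
  assumes B: "\<And>R. R \<in> B \<Longrightarrow> rectangular_parallelepiped R"
    and E: "E \<in> sets lebesgue" and s: "0 \<le> s"
  shows "ennreal s < maximal_operator B (indicator E) x \<longleftrightarrow>
    (\<exists>R\<in>B. x \<in> R \<and> s * measure lebesgue R < measure lebesgue (E \<inter> R))"
proof -
  have "ennreal s < (\<integral>\<^sup>+y\<in>R. ennreal \<bar>indicator E y\<bar> \<partial>lebesgue) / emeasure lebesgue R \<longleftrightarrow>
      s * measure lebesgue R < measure lebesgue (E \<inter> R)" if "R \<in> B" for R
  proof -
    note R = rectangular_parallelepipedD[OF B[OF that]]
    have ER: "E \<inter> R \<in> lmeasurable"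
      using fmeasurable_Int_fmeasurable[OF R(2) E] by (simp add: Int_commute)
    have "(\<integral>\<^sup>+y\<in>R. ennreal \<bar>indicator E y\<bar> \<partial>lebesgue) = (\<integral>\<^sup>+y. indicator (E \<inter> R) y \<partial>lebesgue)"
      by (intro nn_integral_cong) (simp split: split_indicator)
    also have "\<dots> = measure lebesgue (E \<inter> R)"
      using ER by (simp add: fmeasurableD emeasure_eq_measure2)
    finally have "(\<integral>\<^sup>+y\<in>R. ennreal \<bar>indicator E y\<bar> \<partial>lebesgue) / emeasure lebesgue R
        = ennreal (measure lebesgue (E \<inter> R) / measure lebesgue R)"
      using R by (simp add: emeasure_eq_measure2 divide_ennreal)
    then show ?thesis
      using R s by (simp add: ennreal_less_iff pos_less_divide_eq)
  qed
  then show ?thesis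
    unfolding maximal_operator_def less_SUP_iff by blast
qed

text \<open>The preimage of \<open>x\<close> under the dilation about \<open>c\<close> by the factor
  \<open>r\<close> is \<open>c + (x - c) / r\<close>. It lies on the segment from the interior point
  \<open>c\<close> towards \<open>x\<close>, short of the end, hence in the interior of the convex
  set \<open>R\<close>; the dilation maps that interior to an open set.\<close>

lemma homothetic_image_interior:
  fixes R :: "'a::euclidean_space set"
  assumes "convex R" "c \<in> interior R" "x \<in> R" "1 < r"
  shows "x \<in> interior ((\<lambda>y. (1 - r) *\<^sub>R c + r *\<^sub>R y) ` R)"
proof -
  let ?h = "\<lambda>y. (1 - r) *\<^sub>R c + r *\<^sub>R y"
  let ?y = "x - (1 - 1 / r) *\<^sub>R (x - c)"
  have "?y \<in> interior R"
    using assms by (intro mem_interior_convex_shrink) auto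
  moreover have "?h ?y = x"
    using assms by (simp add: algebra_simps)
  moreover have "open (?h ` interior R)"
    using assms open_affinity[of "interior R" r "(1 - r) *\<^sub>R c"] by simp
  moreover have "?h ` interior R \<subseteq> ?h ` R"
    using interior_subset by blast
  ultimately show ?thesis
    using interior_maximal[of "?h ` interior R" "?h ` R"] by force
qed

text \<open>Dilating a witness slightly about an interior point puts \<open>x\<close> into the
  interior. The dilate contains the original set, so the part in \<open>E\<close> does not shrink,
  and the strict inequality survives because the volume depends continuously on the factor.\<close>

lemma less_maximal_operator_indicator_interior:
  fixes B :: "(real ^ 'n) set set"
  assumes B: "\<And>R. R \<in> B \<Longrightarrow> rectangular_parallelepiped R" and hom: "homothecy_invariant B"
    and E: "E \<in> sets lebesgue" and s: "0 \<le> s"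
    and x: "ennreal s < maximal_operator B (indicator E) x"
  obtains R where "R \<in> B" "x \<in> interior R" "s * measure lebesgue R < measure lebesgue (E \<inter> R)"
proof -
  let ?n = "DIM(real ^ 'n)"
  obtain R where RB: "R \<in> B" and xR: "x \<in> R"
    and less: "s * measure lebesgue R < measure lebesgue (E \<inter> R)"
    using x less_maximal_operator_indicator_iff[OF B E s] by blast
  note R = rectangular_parallelepipedD[OF B[OF RB]]
  \<comment> \<open>A convex set with empty interior is negligible, so positive measure provides a
    centre \<open>c\<close> for the dilation.\<close>
  have "\<not> negligible R"
    using R(3) negligible_imp_measure0 by fastforce
  then obtain c where c: "c \<in> interior R"
    using R(1) negligible_convex_interior by blast
  have "((\<lambda>r. s * (r ^ ?n * measure lebesgue R)) \<longlongrightarrow> s * (1 ^ ?n * measure lebesgue R)) (at_right 1)"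
    by (intro tendsto_intros)
  then have "\<forall>\<^sub>F r in at_right 1. s * (r ^ ?n * measure lebesgue R) < measure lebesgue (E \<inter> R)"
    using less by (intro order_tendstoD) auto
  then obtain b where b: "b > 1"
    "\<And>r. 1 < r \<Longrightarrow> r < b \<Longrightarrow> s * (r ^ ?n * measure lebesgue R) < measure lebesgue (E \<inter> R)"
    unfolding eventually_at_right_field by blast
  obtain r where r: "1 < r" "r < b"
    using dense b(1) by blast
  let ?R = "(\<lambda>y. (1 - r) *\<^sub>R c + r *\<^sub>R y) ` R"
  \<comment> \<open>The dilation about \<open>c\<close> is the homothety with ratio \<open>r\<close>
    and translation vector \<open>(1 - r) *\<^sub>R c\<close>.\<close>
  have RB': "?R \<in> B"
    using hom RB r unfolding homothecy_invariant_def by auto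
  note R' = rectangular_parallelepipedD[OF B[OF RB']]
  have "R \<subseteq> ?R"
    using homothetic_image_interior[OF R(1) c _ r(1)] interior_subset by blast
  then have "measure lebesgue (E \<inter> R) \<le> measure lebesgue (E \<inter> ?R)"
    using E R R' fmeasurable_Int_fmeasurable[OF R'(2) E]
    by (intro measure_mono_fmeasurable) (auto simp: Int_commute dest: fmeasurableD)
  moreover have "measure lebesgue ?R = r ^ ?n * measure lebesgue R"
    using measure_lebesgue_affine[of r "(1 - r) *\<^sub>R c" R] r by (simp add: add.commute)
  ultimately show ?thesis
    using that[OF RB'] b(2)[OF r] homothetic_image_interior[OF R(1) c xR r(1)] by simp
qed

text \<open>The interior of a witness consists of points with the same witness. Openness is wanted
  for measurability, on which monotonicity of \<open>emeasure\<close> depends.\<close>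

lemma open_maximal_operator_indicator_superlevel:
  fixes B :: "(real ^ 'n) set set"
  assumes B: "\<And>R. R \<in> B \<Longrightarrow> rectangular_parallelepiped R" and hom: "homothecy_invariant B"
    and E: "E \<in> sets lebesgue" and s: "0 \<le> s"
  shows "open {x. ennreal s < maximal_operator B (indicator E) x}"
proof (subst open_subopen, intro ballI)
  fix x assume "x \<in> {x. ennreal s < maximal_operator B (indicator E) x}"
  then obtain R where R: "R \<in> B" "x \<in> interior R" "s * measure lebesgue R < measure lebesgue (E \<inter> R)"
    using less_maximal_operator_indicator_interior[OF B hom E s] by blast
  then have "interior R \<subseteq> {x. ennreal s < maximal_operator B (indicator E) x}"
    using less_maximal_operator_indicator_iff[OF B E s] interior_subset by blast
  with R show "\<exists>T. open T \<and> x \<in> T \<and> T \<subseteq> {x. ennreal s < maximal_operator B (indicator E) x}"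
    using open_interior by blast
qed

section \<open>The Tauberian estimate for unions of members of high density\<close>

text \<open>The Tauberian condition is applied to \<open>E \<union> N\<close>, where
  \<open>N\<close> fills the proportion \<open>e\<close> of what \<open>E\<close> leaves free in
  each member of \<open>F\<close>. The union also appears on the right, with a small factor, to be
  absorbed later.\<close>

lemma emeasure_Union_dense_le:
  fixes B :: "(real ^ 'n) set set"
  assumes B: "\<And>R. R \<in> B \<Longrightarrow> rectangular_parallelepiped R" and hom: "homothecy_invariant B"
    and \<gamma>: "0 < \<gamma>" "\<gamma> < 1"
    and tauberian: "\<And>E. E \<in> sets lebesgue \<Longrightarrow>
      emeasure lebesgue {x. maximal_operator B (indicator E) x > ennreal \<gamma>} \<le> C * emeasure lebesgue E"
    and E: "E \<in> sets lebesgue" and e: "0 < e" "e < 1"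
    and F: "finite F" "F \<subseteq> B"
    and dense: "\<And>R. R \<in> F \<Longrightarrow> (\<gamma> - e) / (1 - e) * measure lebesgue R < measure lebesgue (E \<inter> R)"
  shows "emeasure lebesgue (\<Union>F) \<le> C * (emeasure lebesgue E + e * emeasure lebesgue (\<Union>F))"
proof -
  have R: "R \<in> lmeasurable" if "R \<in> F" for R
    using rectangular_parallelepipedD[OF B] that F by blast
  have U: "\<Union>F \<in> lmeasurable"
    using fmeasurable.finite_Union[OF F(1)] R by blast
  have UE: "\<Union>F - E \<in> lmeasurable"
    using U E by (rule fmeasurable_Diff)
  obtain N where N: "N \<in> lmeasurable" "N \<subseteq> \<Union>F - E"
      "measure lebesgue N = e * measure lebesgue (\<Union>F - E)"
      "\<forall>S\<in>F. measure lebesgue (N \<inter> S) = e * measure lebesgue ((\<Union>F - E) \<inter> S)"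
    using lmeasurable_subset_of_proportion_simultaneous[OF F(1) _ UE, of e] R e
    by (auto dest: fmeasurableD)
  have EN: "E \<union> N \<in> sets lebesgue"
    using E N by (auto dest: fmeasurableD)
  have "\<gamma> * measure lebesgue S < measure lebesgue ((E \<union> N) \<inter> S)" if S: "S \<in> F" for S
  proof -
    have S': "S \<in> lmeasurable"
      using R S by blast
    have ES: "E \<inter> S \<in> lmeasurable"
      using fmeasurable_Int_fmeasurable[OF S' E] by (simp add: Int_commute)
    have SE: "S - E \<in> lmeasurable" and NS: "N \<inter> S \<in> lmeasurable"
      using S' E N by (auto intro: fmeasurable_Int_fmeasurable fmeasurable_Diff dest: fmeasurableD)
    have "(\<Union>F - E) \<inter> S = S - E"
      using S by blast
    then have "measure lebesgue (N \<inter> S) = e * measure lebesgue (S - E)"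
      using N(4) S by simp
    moreover have "measure lebesgue (E \<inter> S \<union> (S - E)) = measure lebesgue (E \<inter> S) + measure lebesgue (S - E)"
    proof -
      have "(E \<inter> S) \<inter> (S - E) = {}"
        by blast
      then show ?thesis
        using measure_Un3[OF ES SE] by simp
    qed
    moreover have "E \<inter> S \<union> (S - E) = S"
      by blast
    moreover have "measure lebesgue ((E \<union> N) \<inter> S) = measure lebesgue (E \<inter> S) + measure lebesgue (N \<inter> S)"
    proof -
      have "(E \<inter> S) \<inter> (N \<inter> S) = {}"
        using N by blast
      then show ?thesis
        using measure_Un3[OF ES NS] by (simp add: Int_Un_distrib2)
    qed
    ultimately have eq: "measure lebesgue ((E \<union> N) \<inter> S)
        = (1 - e) * measure lebesgue (E \<inter> S) + e * measure lebesgue S"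
      by (simp add: algebra_simps)
    \<comment> \<open>The threshold \<open>(\<gamma> - e) / (1 - e)\<close> is the solution
      \<open>s\<close> of \<open>(1 - e) * s + e = \<gamma>\<close>, which matches the convex
      combination in \<open>eq\<close>.\<close>
    have "(\<gamma> - e) * measure lebesgue S < (1 - e) * measure lebesgue (E \<inter> S)"
      using dense[OF S] e by (simp add: field_simps)
    then show ?thesis
      unfolding eq by (simp add: algebra_simps)
  qed
  then have "\<Union>F \<subseteq> {x. maximal_operator B (indicator (E \<union> N)) x > ennreal \<gamma>}"
    using less_maximal_operator_indicator_iff[OF B EN, where s = \<gamma>] \<gamma> F by fastforce
  then have "emeasure lebesgue (\<Union>F)
      \<le> emeasure lebesgue {x. maximal_operator B (indicator (E \<union> N)) x > ennreal \<gamma>}"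
    using open_maximal_operator_indicator_superlevel[OF B hom EN, where s = \<gamma>] \<gamma>
    by (intro emeasure_mono) auto
  also have "\<dots> \<le> C * emeasure lebesgue (E \<union> N)"
    using EN by (rule tauberian)
  also have "\<dots> \<le> C * (emeasure lebesgue E + e * emeasure lebesgue (\<Union>F))"
  proof (rule mult_left_mono)
    have "measure lebesgue N \<le> e * measure lebesgue (\<Union>F)"
      unfolding N(3) using U UE e by (intro mult_left_mono measure_mono_fmeasurable) (auto dest: fmeasurableD)
    then have "emeasure lebesgue N \<le> e * emeasure lebesgue (\<Union>F)"
      using N(1) U e by (simp add: emeasure_eq_measure2 ennreal_mult'[symmetric])
    moreover have "emeasure lebesgue (E \<union> N) \<le> emeasure lebesgue E + emeasure lebesgue N"
      using E N by (intro emeasure_subadditive) (auto dest: fmeasurableD)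
    ultimately show "emeasure lebesgue (E \<union> N) \<le> emeasure lebesgue E + e * emeasure lebesgue (\<Union>F)"
      by (meson add_left_mono order_trans)
  qed simp
  finally show ?thesis .
qed

text \<open>Continuity from below along initial segments of an enumeration. It extends the estimate
  from finite families, to which the inductive choice of \<open>N\<close> is confined.\<close>

lemma emeasure_countable_Union_le:
  assumes "countable D" "\<And>S. S \<in> D \<Longrightarrow> S \<in> sets M"
    and bound: "\<And>F. finite F \<Longrightarrow> F \<subseteq> D \<Longrightarrow> emeasure M (\<Union>F) \<le> b"
  shows "emeasure M (\<Union>D) \<le> b"
proof (cases "D = {}")
  case True
  then show ?thesis
    by simp
next
  case False
  define A where "A n = \<Union>(from_nat_into D ` {..n})" for n
  have sub: "from_nat_into D ` {..n} \<subseteq> D" for n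
    using False by (auto intro: from_nat_into)
  have "\<Union>D = \<Union>(range (from_nat_into D))"
    by (simp add: range_from_nat_into[OF False assms(1)])
  also have "\<dots> = (\<Union>n. A n)"
    unfolding A_def by auto
  also have "emeasure M \<dots> = (SUP n. emeasure M (A n))"
  proof (rule SUP_emeasure_incseq[symmetric])
    show "range A \<subseteq> sets M"
      using sub assms(2) unfolding A_def by blast
    show "incseq A"
      unfolding A_def incseq_def by (auto intro: order_trans)
  qed
  also have "\<dots> \<le> b"
    unfolding A_def by (intro SUP_least bound sub) simp
  finally show ?thesis .
qed

section \<open>Countable covering and passage to the limit\<close>

theorem theorem2:
  fixes B :: "(real ^ 'n) set set" and \<gamma> :: real and C :: ennreal
  assumes "\<And>R. R \<in> B \<Longrightarrow> rectangular_parallelepiped R"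
    and "homothecy_invariant B"
    and "0 < \<gamma>" and "\<gamma> < 1"
    and "C < \<infinity>"
    and "\<And>E. E \<in> sets lebesgue \<Longrightarrow>
           emeasure lebesgue {x. maximal_operator B (indicator E) x > ennreal \<gamma>}
             \<le> C * emeasure lebesgue E"
  shows "\<And>E. E \<in> sets lebesgue \<Longrightarrow>
           emeasure lebesgue {x. maximal_operator B (indicator E) x \<ge> ennreal \<gamma>}
             \<le> C * emeasure lebesgue E"
proof -
  fix E :: "(real ^ 'n) set" assume E: "E \<in> sets lebesgue"
  let ?A = "{x. maximal_operator B (indicator E) x \<ge> ennreal \<gamma>}"
  show "emeasure lebesgue ?A \<le> C * emeasure lebesgue E"
  proof (cases "C * emeasure lebesgue E = \<infinity>")
    case True
    then show ?thesis
      by simp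
  next
    \<comment> \<open>Only the product is turned into a real number: when \<open>C = 0\<close> the
      set \<open>E\<close> may have infinite measure, and the product is still 0.\<close>
    case False
    then obtain k where k: "C * emeasure lebesgue E = ennreal k" "0 \<le> k"
      by (cases "C * emeasure lebesgue E") auto
    obtain c where c: "C = ennreal c" "0 \<le> c"
      using assms(5) by (cases C) auto
    \<comment> \<open>The bound \<open>e < \<gamma>\<close> keeps the lowered threshold
      \<open>?s\<close> nonnegative, and \<open>c * e < 1\<close> permits the absorption.\<close>
    have bound: "emeasure lebesgue ?A \<le> ennreal (k / (1 - c * e))"
      if e: "0 < e" "e < \<gamma>" "c * e < 1" for e
    proof -
      let ?s = "(\<gamma> - e) / (1 - e)"
      define D where "D = {R \<in> B. ?s * measure lebesgue R < measure lebesgue (E \<inter> R)}"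
      have s: "0 \<le> ?s" "?s < \<gamma>"
        using e assms(3,4) by (auto simp: field_simps)
      have cover: "?A \<subseteq> \<Union>(interior ` D)"
      proof
        fix x assume "x \<in> ?A"
        then have "ennreal \<gamma> \<le> maximal_operator B (indicator E) x"
          by simp
        \<comment> \<open>A supremum equal to \<open>\<gamma>\<close> need not be attained, but the
          smaller value \<open>?s\<close> is exceeded by a single member.\<close>
        moreover have "ennreal ?s < ennreal \<gamma>"
          using s by (simp only: ennreal_less_iff)
        ultimately have "ennreal ?s < maximal_operator B (indicator E) x"
          by (rule less_le_trans[rotated])
        then obtain R where "R \<in> B" "x \<in> interior R" "?s * measure lebesgue R < measure lebesgue (E \<inter> R)"
          using less_maximal_operator_indicator_interior[OF assms(1,2) E s(1)] by blast
        then show "x \<in> \<Union>(interior ` D)"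
          unfolding D_def by blast
      qed
      \<comment> \<open>Lindelof needs open sets, so it is applied to the interiors; the countable
        subcover is then pulled back to members of \<open>D\<close>.\<close>
      obtain G where G: "G \<subseteq> interior ` D" "countable G" "\<Union>G = \<Union>(interior ` D)"
        using Lindelof[of "interior ` D"] by auto
      then obtain D' where D': "D' \<subseteq> D" "countable D'" "G = interior ` D'"
        using countable_subset_image[of G interior D] by blast
      have RD: "R \<in> lmeasurable" if "R \<in> D'" for R
        using rectangular_parallelepipedD[OF assms(1)] that D' unfolding D_def by blast
      have "?A \<subseteq> \<Union>D'"
      proof -
        have "\<Union>(interior ` D') \<subseteq> \<Union>D'"
          using interior_subset by (rule UN_mono[OF subset_refl, where g = "\<lambda>R. R", simplified])
        then show ?thesis
          using cover unfolding G(3)[symmetric] D'(3) by (rule order_trans[rotated])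
      qed
      then have "emeasure lebesgue ?A \<le> emeasure lebesgue (\<Union>D')"
        using D'(2) RD by (intro emeasure_mono sets.countable_Union) (auto dest: fmeasurableD)
      also have "\<dots> \<le> ennreal (k / (1 - c * e))"
      proof (rule emeasure_countable_Union_le[OF D'(2)])
        show "R \<in> sets lebesgue" if "R \<in> D'" for R
          using RD that by (auto dest: fmeasurableD)
        fix F assume F: "finite F" "F \<subseteq> D'"
        have U: "\<Union>F \<in> lmeasurable"
          using fmeasurable.finite_Union[OF F(1)] F RD by blast
        \<comment> \<open>A finite union of members has finite measure, so
          \<open>c * (e * u)\<close> can be subtracted from both sides of the estimate.\<close>
        define u where "u = measure lebesgue (\<Union>F)"
        have u: "emeasure lebesgue (\<Union>F) = ennreal u" "0 \<le> u"
          using U by (simp_all add: u_def emeasure_eq_measure2)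
        have "emeasure lebesgue (\<Union>F) \<le> C * (emeasure lebesgue E + e * emeasure lebesgue (\<Union>F))"
          using F D' e assms(4)
          by (intro emeasure_Union_dense_le[OF assms(1-4) assms(6) E]) (auto simp: D_def)
        also have "\<dots> = ennreal (k + c * (e * u))"
          using e k c u by (simp add: distrib_left ennreal_mult ennreal_plus)
        finally have "ennreal u \<le> ennreal (k + c * (e * u))"
          unfolding u .
        then have "u \<le> k + c * (e * u)"
          by (rule ennreal_le_iff[THEN iffD1, rotated]) (use u k c e in simp)
        then have "u \<le> k / (1 - c * e)"
          using e by (simp add: field_simps)
        then show "emeasure lebesgue (\<Union>F) \<le> ennreal (k / (1 - c * e))"
          unfolding u by (rule ennreal_leI)
      qed
      finally show ?thesis .
    qed
    \<comment> \<open>The left side of \<open>bound\<close> does not depend on \<open>e\<close>, so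
      letting \<open>e\<close> decrease to 0 recovers the constant \<open>C\<close>
      unchanged.\<close>
    have "((\<lambda>e. k / (1 - c * e)) \<longlongrightarrow> k / (1 - c * 0)) (at_right 0)"
      by (intro tendsto_intros) auto
    then have "((\<lambda>e. ennreal (k / (1 - c * e))) \<longlongrightarrow> ennreal k) (at_right 0)"
      by (intro tendsto_ennrealI) simp
    moreover have "\<forall>\<^sub>F e in at_right 0. emeasure lebesgue ?A \<le> ennreal (k / (1 - c * e))"
    proof -
      have "((\<lambda>e. c * e) \<longlongrightarrow> c * 0) (at_right 0)"
        by (intro tendsto_intros)
      then have "\<forall>\<^sub>F e in at_right 0. c * e < 1"
        by (rule order_tendstoD) simp
      moreover have "\<forall>\<^sub>F e in at_right 0. 0 < e \<and> e < \<gamma>"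
        using assms(3) by (auto simp: eventually_at_right_field)
      ultimately show ?thesis
        by eventually_elim (use bound in blast)
    qed
    ultimately show ?thesis
      unfolding k(1) by (rule tendsto_lowerbound) simp
  qed
qed

end
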